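(* Let $\mathcal{A}$ be a (randomized) algorithm that solves the wake-up problem in $f(n)$ rounds, in expectation, in the radio network model with a single channel and no collision detection (that is, for every network size $n$ and every non-empty set of activated nodes, the expected number of rounds until the problem is solved is at most $f(n)$). Then $f(n)\in\Omega(\log n)$.
   Context: Radio network model (single hop, single channel, no collision detection): there are $n$ nodes with unique ids from $[n]=\{1,\dots,n\}$, every two of which are neighbors. Executions proceed in synchronous rounds. In each round each node either transmits a message or receives. A node $u$ receives a message from $v$ in a round if and only if $u$ is receiving, $v$ is transmitting, and $v$ is the only neighbor of $u$ transmitting in that round; otherwise $u$ receives nothing, and nodes cannot distinguish silence from collision. Wake-up problem: all nodes are initially inactive; at the beginning of the execution an adversary activates an arbitrary non-empty subset of the nodes. Inactive nodes can only listen; active nodes execute an arbitrary randomized algorithm and have no advance knowledge of the identities of the other active nodes. The problem is solved in the first round in which exactly one active node transmits (an active node broadcasts alone). Asymptotics are as $n\to\infty$. *)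

theory Defs
  imports "HOL-Probability.Probability" "HOL-Library.Landau_Symbols"
begin

datatype 'm action = Listen | Transmit 'm

text \<open>
  A randomized algorithm, for every network size \<open>n\<close> and node id \<open>v\<close>: \<open>seed alg n v\<close> is the
  distribution of the private randomness of \<open>v\<close> for the whole execution, and \<open>act alg n v s h\<close> is
  what \<open>v\<close> does when active, with randomness \<open>s\<close>, in the round preceded by \<open>length h\<close> rounds in
  which it received \<open>h\<close>. The entry \<open>None\<close> in \<open>h\<close> means that nothing was received (silence,
  collision, or own transmission). The past actions of \<open>v\<close> are determined by \<open>s\<close> and \<open>h\<close>.
\<close>
record ('s, 'm) algorithm =
  seed :: "nat \<Rightarrow> nat \<Rightarrow> 's measure"
  act :: "nat \<Rightarrow> nat \<Rightarrow> 's \<Rightarrow> 'm option list \<Rightarrow> 'm action"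

definition randomized_algorithm :: "('s, 'm) algorithm \<Rightarrow> bool" where
  "randomized_algorithm alg \<longleftrightarrow>
     (\<forall>n. \<forall>v\<in>{1..n}. prob_space (seed alg n v) \<and>
        (\<forall>h. (\<lambda>s. act alg n v s h) \<in> measurable (seed alg n v) (count_space UNIV)))"

definition neighbors :: "nat \<Rightarrow> nat \<Rightarrow> nat set" where
  "neighbors n u = {1..n} - {u}"

definition receives_from ::
    "nat \<Rightarrow> (nat \<Rightarrow> 'm action) \<Rightarrow> nat \<Rightarrow> nat \<Rightarrow> 'm \<Rightarrow> bool" where
  "receives_from n a u v m \<longleftrightarrow>
     a u = Listen \<and> v \<in> neighbors n u \<and> a v = Transmit m \<and>
     (\<forall>w\<in>neighbors n u. w \<noteq> v \<longrightarrow> a w = Listen)"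

definition reception :: "nat \<Rightarrow> (nat \<Rightarrow> 'm action) \<Rightarrow> nat \<Rightarrow> 'm option" where
  "reception n a u =
     (if \<exists>v m. receives_from n a u v m
      then Some (THE m. \<exists>v. receives_from n a u v m) else None)"

definition choose_actions ::
    "('s, 'm) algorithm \<Rightarrow> nat \<Rightarrow> nat set \<Rightarrow> (nat \<Rightarrow> 's) \<Rightarrow>
     (nat \<Rightarrow> 'm option list) \<Rightarrow> nat \<Rightarrow> 'm action" where
  "choose_actions alg n A \<omega> H v = (if v \<in> A then act alg n v (\<omega> v) (H v) else Listen)"

text \<open>
  The receptions of every node in the first \<open>t\<close> rounds, when \<open>A\<close> is the set of activated nodes and
  \<open>\<omega> v\<close> is the randomness of node \<open>v\<close>. Rounds are indexed from \<open>0\<close>.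
\<close>
primrec history ::
    "('s, 'm) algorithm \<Rightarrow> nat \<Rightarrow> nat set \<Rightarrow> (nat \<Rightarrow> 's) \<Rightarrow> nat \<Rightarrow> nat \<Rightarrow> 'm option list" where
  "history alg n A \<omega> 0 = (\<lambda>v. [])"
| "history alg n A \<omega> (Suc t) =
     (\<lambda>v. history alg n A \<omega> t v @
        [reception n (choose_actions alg n A \<omega> (history alg n A \<omega> t)) v])"

definition action_in ::
    "('s, 'm) algorithm \<Rightarrow> nat \<Rightarrow> nat set \<Rightarrow> (nat \<Rightarrow> 's) \<Rightarrow> nat \<Rightarrow> nat \<Rightarrow> 'm action" where
  "action_in alg n A \<omega> t = choose_actions alg n A \<omega> (history alg n A \<omega> t)"

definition broadcasts_alone ::
    "('s, 'm) algorithm \<Rightarrow> nat \<Rightarrow> nat set \<Rightarrow> (nat \<Rightarrow> 's) \<Rightarrow> nat \<Rightarrow> bool" where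
  "broadcasts_alone alg n A \<omega> t \<longleftrightarrow> (\<exists>!v. v \<in> A \<and> action_in alg n A \<omega> t v \<noteq> Listen)"

text \<open>
  The number of rounds until the problem is solved, including the solving round (hence \<open>Suc\<close>).
\<close>
definition wakeup_time ::
    "('s, 'm) algorithm \<Rightarrow> nat \<Rightarrow> nat set \<Rightarrow> (nat \<Rightarrow> 's) \<Rightarrow> enat" where
  "wakeup_time alg n A \<omega> =
     (if \<exists>t. broadcasts_alone alg n A \<omega> t
      then enat (Suc (LEAST t. broadcasts_alone alg n A \<omega> t)) else \<infinity>)"

text \<open>
  The product measure makes the random choices of different nodes independent. The integrand is
  measurable for every randomized algorithm: as long as no node has broadcast alone, all entries
  of all histories are \<open>None\<close>, so only countably many values of \<open>h\<close> matter.
\<close>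
definition expected_wakeup_time :: "('s, 'm) algorithm \<Rightarrow> nat \<Rightarrow> nat set \<Rightarrow> ennreal" where
  "expected_wakeup_time alg n A =
     (\<integral>\<^sup>+ \<omega>. ennreal_of_enat (wakeup_time alg n A \<omega>) \<partial>(PiM {1..n} (seed alg n)))"

definition solves_wakeup_in :: "('s, 'm) algorithm \<Rightarrow> (nat \<Rightarrow> real) \<Rightarrow> bool" where
  "solves_wakeup_in alg f \<longleftrightarrow>
     (\<forall>n\<ge>1. \<forall>A. A \<subseteq> {1..n} \<and> A \<noteq> {} \<longrightarrow> expected_wakeup_time alg n A \<le> ennreal (f n))"

end

theory Submission
  imports Defs
begin

text \<open>
  Until some node broadcasts alone nobody receives anything, so the behaviour of an active node is
  determined by its own randomness: in round \<open>t\<close> it transmits with a probability \<open>p v\<close> that does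
  not depend on the set of active nodes, and independently of the other nodes. Activate every node
  independently with probability \<open>q = 1 / 2 ^ i\<close> and let \<open>P\<close> be the sum of the \<open>p v\<close>. The probability
  that exactly one node transmits in round \<open>t\<close> is then at most \<open>3 q P exp (- q P)\<close>, and the sum of
  these bounds over all \<open>i\<close> is at most \<open>6\<close>, whatever \<open>P\<close> is. So over \<open>k\<close> scales \<open>i < k\<close>, where \<open>k\<close> is about
  \<open>log 2 n\<close>, \<open>T\<close> rounds succeed with average probability at most \<open>6 T / k\<close>, which is at most \<open>1 / 4\<close>
  for \<open>T = k div 24\<close>, while the active set is non-empty with probability at least \<open>1 / 2\<close>.
\<close>

section \<open>Exactly one of several independent events in a product space\<close>

text \<open>The event is the disjoint union over \<open>v\<close> of the boxes \<open>B v\<close> in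
  which coordinate \<open>v\<close> hits \<open>E v\<close> and every other coordinate in
  \<open>A\<close> misses. Coordinates outside \<open>A\<close> are unconstrained and contribute a
  factor 1.\<close>

lemma
  fixes M :: "'i \<Rightarrow> 's measure"
  assumes "finite I" "A \<subseteq> I"
    and prob: "\<And>i. i \<in> I \<Longrightarrow> prob_space (M i)"
    and E: "\<And>i. i \<in> I \<Longrightarrow> E i \<in> sets (M i)"
  defines "S \<equiv> {\<omega> \<in> space (PiM I M). \<exists>!v. v \<in> A \<and> \<omega> v \<in> E v}"
  shows sets_PiM_ex1: "S \<in> sets (PiM I M)"
    and measure_PiM_ex1: "measure (PiM I M) S =
      (\<Sum>v\<in>A. measure (M v) (E v) * (\<Prod>w\<in>A - {v}. 1 - measure (M w) (E w)))"
proof -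
  define B where "B v = PiE I (\<lambda>w. if w = v then E w else if w \<in> A then space (M w) - E w
    else space (M w))" for v
  have "finite A" using assms(1,2) finite_subset by blast
  have subE: "E i \<subseteq> space (M i)" if "i \<in> I" for i
    using E[OF that] sets.sets_into_space by blast
  have B_iff: "\<omega> \<in> B v \<longleftrightarrow>
      \<omega> \<in> space (PiM I M) \<and> \<omega> v \<in> E v \<and> (\<forall>w\<in>A. w \<noteq> v \<longrightarrow> \<omega> w \<notin> E w)"
    if "v \<in> A" for \<omega> v
  proof
    assume \<omega>: "\<omega> \<in> B v"
    have mem: "\<omega> w \<in> (if w = v then E w else if w \<in> A then space (M w) - E w
        else space (M w))" if "w \<in> I" for w
      using \<omega> that by (auto simp only: B_def PiE_iff)
    have "\<omega> w \<in> space (M w)" if "w \<in> I" for w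
      using mem[OF that] subE[OF that] by (simp split: if_splits) blast
    moreover have "\<omega> \<in> extensional I"
      using \<omega> by (simp add: B_def PiE_iff)
    ultimately have "\<omega> \<in> space (PiM I M)"
      by (simp add: space_PiM PiE_iff)
    moreover have "\<omega> v \<in> E v"
      using mem[of v] that assms(2) by auto
    moreover have "\<omega> w \<notin> E w" if "w \<in> A" "w \<noteq> v" for w
      using mem[of w] that assms(2) by auto
    ultimately show "\<omega> \<in> space (PiM I M) \<and> \<omega> v \<in> E v \<and> (\<forall>w\<in>A. w \<noteq> v \<longrightarrow> \<omega> w \<notin> E w)"
      by blast
  next
    assume "\<omega> \<in> space (PiM I M) \<and> \<omega> v \<in> E v \<and> (\<forall>w\<in>A. w \<noteq> v \<longrightarrow> \<omega> w \<notin> E w)"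
    then show "\<omega> \<in> B v"
      by (simp add: B_def space_PiM PiE_iff)
  qed
  have S: "S = (\<Union>v\<in>A. B v)"
  proof (intro equalityI subsetI)
    fix \<omega> assume "\<omega> \<in> S"
    then obtain v where "v \<in> A" "\<omega> \<in> B v"
      unfolding S_def mem_Collect_eq by (metis B_iff)
    then show "\<omega> \<in> (\<Union>v\<in>A. B v)" by blast
  next
    fix \<omega> assume "\<omega> \<in> (\<Union>v\<in>A. B v)"
    then obtain v where "v \<in> A" "\<omega> \<in> B v" by blast
    then show "\<omega> \<in> S"
      unfolding S_def mem_Collect_eq by (metis B_iff)
  qed
  have B: "B v \<in> sets (PiM I M)" for v
    unfolding B_def by (intro sets_PiM_I_finite assms) (auto intro: E)
  show "S \<in> sets (PiM I M)"
    unfolding S using \<open>finite A\<close> B by blast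
  interpret prob_space "PiM I M"
    using prob by (rule prob_space_PiM)
  have box: "measure (PiM I M) (PiE I F) = (\<Prod>i\<in>I. measure (M i) (F i))"
    if "\<And>i. i \<in> I \<Longrightarrow> F i \<in> sets (M i)" for F
  proof -
    have "PiE I F = prod_emb I M I (PiE I F)"
      using that by (intro prod_emb_PiE_same_index[symmetric] sets.sets_into_space)
    then have "emeasure (PiM I M) (PiE I F) = (\<Prod>i\<in>I. emeasure (M i) (F i))"
      using emeasure_PiM_emb[of I M I F, OF prob subset_refl assms(1) that] by simp
    also have "\<dots> = ennreal (\<Prod>i\<in>I. measure (M i) (F i))"
      using prob by (subst prod_ennreal[symmetric])
        (auto intro!: prod.cong finite_measure.emeasure_eq_measure prob_space.finite_measure)
    finally show ?thesis by (simp add: measure_def prod_nonneg)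
  qed
  have mB: "measure (PiM I M) (B v) =
      measure (M v) (E v) * (\<Prod>w\<in>A - {v}. 1 - measure (M w) (E w))" if "v \<in> A" for v
  proof -
    have "measure (PiM I M) (B v) = (\<Prod>w\<in>I. measure (M w)
      (if w = v then E w else if w \<in> A then space (M w) - E w else space (M w)))"
      unfolding B_def by (rule box) (auto intro: E)
    also have "\<dots> = (\<Prod>w\<in>A. if w = v then measure (M w) (E w) else 1 - measure (M w) (E w))"
      using assms(2) prob E that
      by (intro prod.mono_neutral_cong_right assms(1))
        (auto simp: prob_space.prob_space prob_space.prob_compl)
    also have "\<dots> = measure (M v) (E v) * (\<Prod>w\<in>A - {v}. 1 - measure (M w) (E w))"
      by (subst prod.remove[OF \<open>finite A\<close> that]) (auto intro!: prod.cong)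
    finally show ?thesis .
  qed
  have "disjoint_family_on B A"
    by (auto simp: disjoint_family_on_def B_iff)
  then have "measure (PiM I M) S = (\<Sum>v\<in>A. measure (PiM I M) (B v))"
    unfolding S using B \<open>finite A\<close> by (intro finite_measure_finite_Union) auto
  then show "measure (PiM I M) S =
      (\<Sum>v\<in>A. measure (M v) (E v) * (\<Prod>w\<in>A - {v}. 1 - measure (M w) (E w)))"
    using mB by simp
qed

section \<open>Independent random activation\<close>

text \<open>For independent events with probabilities \<open>p v\<close>, this is the probability
  that exactly one of those indexed by \<open>A\<close> occurs.\<close>

definition solo_prob :: "('i \<Rightarrow> real) \<Rightarrow> 'i set \<Rightarrow> real" where
  "solo_prob p A = (\<Sum>v\<in>A. p v * (\<Prod>w\<in>A - {v}. 1 - p w))"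

text \<open>For \<open>A \<subseteq> I\<close>, the probability that \<open>A\<close> is the random
  subset of \<open>I\<close> that keeps each element independently with probability
  \<open>q\<close>.\<close>

definition subset_weight :: "real \<Rightarrow> 'i set \<Rightarrow> 'i set \<Rightarrow> real" where
  "subset_weight q I A = q ^ card A * (1 - q) ^ card (I - A)"

text \<open>Write each factor as \<open>q * (1 - p w) + (1 - q)\<close>, that is, kept and silent or
  not kept, and expand the product over subsets.\<close>

lemma sum_subset_weight_prod:
  assumes "finite I"
  shows "(\<Sum>A\<in>Pow I. subset_weight q I A * (\<Prod>w\<in>A. 1 - p w)) = (\<Prod>w\<in>I. 1 - q * p w)"
proof -
  have "(\<Prod>w\<in>I. 1 - q * p w) = (\<Prod>w\<in>I. q * (1 - p w) + (1 - q))"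
    by (simp add: algebra_simps)
  also have "\<dots> = (\<Sum>A\<in>Pow I. (\<Prod>w\<in>A. q * (1 - p w)) * (\<Prod>w\<in>I - A. 1 - q))"
    by (rule prod_add[OF assms])
  also have "\<dots> = (\<Sum>A\<in>Pow I. subset_weight q I A * (\<Prod>w\<in>A. 1 - p w))"
    by (intro sum.cong) (auto simp: subset_weight_def prod.distrib mult_ac)
  finally show ?thesis by simp
qed

lemma sum_subset_weight:
  assumes "finite I"
  shows "(\<Sum>A\<in>Pow I. subset_weight q I A) = 1"
  using sum_subset_weight_prod[OF assms, of q "\<lambda>_. 0"] by simp

text \<open>Being activated and then transmitting merge into a single independent event of
  probability \<open>q * p v\<close>. Formally, the sum is split by the solo transmitter
  \<open>v\<close>, and the product identity is applied to \<open>I - {v}\<close>.\<close>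

lemma sum_subset_weight_solo_prob:
  assumes "finite I"
  shows "(\<Sum>A\<in>Pow I. subset_weight q I A * solo_prob p A) = solo_prob (\<lambda>v. q * p v) I"
proof -
  have inner: "(\<Sum>A\<in>{A\<in>Pow I. v \<in> A}. subset_weight q I A * (p v * (\<Prod>w\<in>A - {v}. 1 - p w))) =
      q * p v * (\<Prod>w\<in>I - {v}. 1 - q * p w)" if "v \<in> I" for v
  proof -
    have "(\<Sum>A\<in>{A\<in>Pow I. v \<in> A}. subset_weight q I A * (p v * (\<Prod>w\<in>A - {v}. 1 - p w))) =
        (\<Sum>A\<in>Pow (I - {v}). q * p v * (subset_weight q (I - {v}) A * (\<Prod>w\<in>A. 1 - p w)))"
    \<comment> \<open>Removing \<open>v\<close> from both \<open>A\<close> and \<open>I\<close>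
      keeps the complement and lowers the cardinality of \<open>A\<close> by one, which releases the
      factor \<open>q\<close>.\<close>
    proof (rule sum.reindex_bij_witness[of _ "insert v" "\<lambda>A. A - {v}"])
      fix A assume A: "A \<in> {A \<in> Pow I. v \<in> A}"
      then have "finite A" using assms finite_subset by blast
      then have "card A = Suc (card (A - {v}))"
        using A by (metis (mono_tags, lifting) card.remove mem_Collect_eq)
      moreover have "I - {v} - (A - {v}) = I - A" using A by auto
      ultimately show "q * p v * (subset_weight q (I - {v}) (A - {v}) * (\<Prod>w\<in>A - {v}. 1 - p w)) =
          subset_weight q I A * (p v * (\<Prod>w\<in>A - {v}. 1 - p w))"
        by (simp add: subset_weight_def)
    qed (use that in auto)
    then show ?thesis
      using sum_subset_weight_prod[of "I - {v}" q p] assms by (simp flip: sum_distrib_left)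
  qed
  have "(\<Sum>A\<in>Pow I. subset_weight q I A * solo_prob p A) =
      (\<Sum>A\<in>Pow I. \<Sum>v\<in>I. if v \<in> A then
        subset_weight q I A * (p v * (\<Prod>w\<in>A - {v}. 1 - p w)) else 0)"
    unfolding solo_prob_def sum_distrib_left using assms
    by (intro sum.cong refl sum.mono_neutral_cong_left) auto
  also have "\<dots> = (\<Sum>v\<in>I. \<Sum>A\<in>{A\<in>Pow I. v \<in> A}.
      subset_weight q I A * (p v * (\<Prod>w\<in>A - {v}. 1 - p w)))"
    using assms by (subst sum.swap) (simp only: sum.inter_filter finite_Pow_iff)
  also have "\<dots> = solo_prob (\<lambda>v. q * p v) I"
    unfolding solo_prob_def by (intro sum.cong refl inner)
  finally show ?thesis .
qed

text \<open>By \<open>1 - x \<le> exp (- x)\<close> the product is at most the exponential of a sum.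
  That sum misses the term of \<open>v\<close>, which costs a factor
  \<open>exp (p v) \<le> exp 1 \<le> 3\<close>.\<close>

lemma solo_prob_le:
  assumes "finite I" "\<And>v. v \<in> I \<Longrightarrow> 0 \<le> p v" "\<And>v. v \<in> I \<Longrightarrow> p v \<le> 1"
  shows "solo_prob p I \<le> 3 * (sum p I * exp (- sum p I))"
proof -
  have "p v * (\<Prod>w\<in>I - {v}. 1 - p w) \<le> p v * (3 * exp (- sum p I))" if "v \<in> I" for v
  proof -
    have "(\<Prod>w\<in>I - {v}. 1 - p w) \<le> (\<Prod>w\<in>I - {v}. exp (- p w))"
      using assms(3) exp_ge_add_one_self[of "- p w" for w] by (intro prod_mono) auto
    also have "\<dots> = exp (p v) * exp (- sum p I)"
      using sum.remove[OF assms(1) that, of p] assms(1)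
      by (simp add: exp_sum[symmetric] sum_negf flip: exp_add)
    also have "\<dots> \<le> 3 * exp (- sum p I)"
      using exp_le assms(3)[OF that] by (intro mult_right_mono) (auto intro: order_trans[of _ "exp 1"])
    finally show ?thesis
      using assms(2)[OF that] by (intro mult_left_mono)
  qed
  then have "solo_prob p I \<le> (\<Sum>v\<in>I. p v * (3 * exp (- sum p I)))"
    unfolding solo_prob_def by (rule sum_mono)
  then show ?thesis by (simp add: mult_ac flip: sum_distrib_right)
qed

section \<open>A dyadic sum with a uniform bound\<close>

text \<open>Multiply \<open>y / 2 \<le> exp (y / 2) - 1\<close> by \<open>exp (- y)\<close>. The
  bound is a difference of values at \<open>y / 2\<close> and \<open>y\<close>, so that it
  telescopes under repeated halving of \<open>y\<close>.\<close>

lemma mult_exp_minus_le: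
  fixes y :: real
  shows "y * exp (- y) \<le> 2 * (exp (- (y / 2)) - exp (- y))"
proof -
  have "exp (- y) * (y / 2) \<le> exp (- y) * (exp (y / 2) - 1)"
  proof (rule mult_left_mono)
    show "y / 2 \<le> exp (y / 2) - 1"
      using exp_ge_add_one_self[of "y / 2"] by linarith
  qed simp
  also have "\<dots> = exp (- (y / 2)) - exp (- y)"
    by (simp add: right_diff_distrib flip: exp_add)
  finally have "exp (- y) * (y / 2) \<le> exp (- (y / 2)) - exp (- y)" .
  then show ?thesis by (simp add: mult.commute)
qed

lemma sum_dyadic_mult_exp_minus_le:
  fixes y :: real
  assumes "0 \<le> y"
  shows "(\<Sum>i<k. y / 2 ^ i * exp (- (y / 2 ^ i))) \<le> 2"
proof -
  have "(\<Sum>i<k. y / 2 ^ i * exp (- (y / 2 ^ i))) \<le>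
      (\<Sum>i<k. 2 * (exp (- (y / 2 ^ Suc i)) - exp (- (y / 2 ^ i))))"
    using mult_exp_minus_le[of "y / 2 ^ i" for i] by (intro sum_mono) (simp add: mult.commute)
  also have "\<dots> = 2 * (exp (- (y / 2 ^ k)) - exp (- y))"
    by (simp only: sum_lessThan_telescope[of "\<lambda>i. exp (- (y / 2 ^ i))"] flip: sum_distrib_left) simp
  also have "\<dots> \<le> 2"
  proof -
    have "exp (- (y / 2 ^ k)) - exp (- y) \<le> 1 - 0"
      using assms by (intro diff_mono) auto
    then show ?thesis by simp
  qed
  finally show ?thesis .
qed

text \<open>The bound depends neither on \<open>k\<close> nor on the total of \<open>p\<close>: one
  round can be effective at only a few activation scales.\<close>

lemma sum_dyadic_solo_prob_le:
  assumes "finite I" "\<And>v. v \<in> I \<Longrightarrow> 0 \<le> p v" "\<And>v. v \<in> I \<Longrightarrow> p v \<le> 1"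
  shows "(\<Sum>i<k. solo_prob (\<lambda>v. (1 / 2) ^ i * p v) I) \<le> 6"
proof -
  have "solo_prob (\<lambda>v. (1 / 2) ^ i * p v) I \<le>
      3 * (sum p I / 2 ^ i * exp (- (sum p I / 2 ^ i)))" for i
  proof -
    have "(1 / 2) ^ i * p v \<le> 1" if "v \<in> I" for v
      using assms that by (intro mult_le_one) (auto simp: power_le_one)
    then have "solo_prob (\<lambda>v. (1 / 2) ^ i * p v) I \<le>
        3 * ((\<Sum>v\<in>I. (1 / 2) ^ i * p v) * exp (- (\<Sum>v\<in>I. (1 / 2) ^ i * p v)))"
      using assms by (intro solo_prob_le) auto
    also have "(\<Sum>v\<in>I. (1 / 2) ^ i * p v) = sum p I / 2 ^ i"
      by (simp add: power_divide sum_divide_distrib)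
    finally show ?thesis .
  qed
  then have "(\<Sum>i<k. solo_prob (\<lambda>v. (1 / 2) ^ i * p v) I) \<le>
      (\<Sum>i<k. 3 * (sum p I / 2 ^ i * exp (- (sum p I / 2 ^ i))))"
    by (rule sum_mono)
  also have "\<dots> \<le> 3 * 2"
    using assms(2) by (simp only: flip: sum_distrib_left)
      (intro mult_left_mono sum_dyadic_mult_exp_minus_le sum_nonneg, auto)
  finally show ?thesis by simp
qed

section \<open>From executions to behaviour independent of the active set\<close>

text \<open>A reception requires a single transmitter in the whole network. As inactive nodes
  listen, that transmitter is in \<open>A\<close> and broadcasts alone.\<close>

lemma history_before_solved:
  assumes "A \<subseteq> {1..n}" "\<And>t'. t' < t \<Longrightarrow> \<not> broadcasts_alone alg n A \<omega> t'"
  shows "history alg n A \<omega> t v = replicate t None"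
  using assms(2)
proof (induction t arbitrary: v)
  case (Suc t)
  have "\<not> receives_from n (action_in alg n A \<omega> t) v u m" for u m
  proof
    assume rec: "receives_from n (action_in alg n A \<omega> t) v u m"
    have inA: "w \<in> A" if "action_in alg n A \<omega> t w \<noteq> Listen" for w
      using that by (auto simp: action_in_def choose_actions_def split: if_splits)
    have "broadcasts_alone alg n A \<omega> t"
      unfolding broadcasts_alone_def
    proof (rule ex1I[of _ u])
      show "u \<in> A \<and> action_in alg n A \<omega> t u \<noteq> Listen"
        using rec inA[of u] by (auto simp: receives_from_def)
      fix w assume "w \<in> A \<and> action_in alg n A \<omega> t w \<noteq> Listen"
      then show "w = u"
        using rec assms(1) by (auto simp: receives_from_def neighbors_def)
    qed
    then show False using Suc.prems by blast
  qed
  then have "reception n (action_in alg n A \<omega> t) v = None"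
    by (simp add: reception_def)
  then show ?case
    using Suc by (simp add: replicate_append_same flip: action_in_def)
qed simp

text \<open>\<open>replicate t None\<close> is the only history possible while the problem is
  unsolved. Fixing it makes the event depend on the randomness of \<open>v\<close> alone.\<close>

definition transmits_blindly :: "('s, 'm) algorithm \<Rightarrow> nat \<Rightarrow> nat \<Rightarrow> nat \<Rightarrow> 's set" where
  "transmits_blindly alg n t v =
    {s \<in> space (seed alg n v). act alg n v s (replicate t None) \<noteq> Listen}"

definition blind_prob :: "('s, 'm) algorithm \<Rightarrow> nat \<Rightarrow> nat \<Rightarrow> nat \<Rightarrow> real" where
  "blind_prob alg n t v = measure (seed alg n v) (transmits_blindly alg n t v)"

text \<open>By strong induction on the round: as long as no round was solo, the actual actions agree
  with the blind ones, so the next round is not solo either.\<close>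

lemma wakeup_time_ge:
  assumes "A \<subseteq> {1..n}" "\<omega> \<in> space (PiM {1..n} (seed alg n))"
    and "\<And>t. t < T \<Longrightarrow> \<not> (\<exists>!v. v \<in> A \<and> \<omega> v \<in> transmits_blindly alg n t v)"
  shows "enat T \<le> wakeup_time alg n A \<omega>"
proof -
  have "\<not> broadcasts_alone alg n A \<omega> t" if "t < T" for t
    using that
  proof (induction t rule: less_induct)
    case (less t)
    then have H: "history alg n A \<omega> t = (\<lambda>v. replicate t None)"
      by (intro ext history_before_solved[OF assms(1)]) auto
    have "v \<in> A \<and> action_in alg n A \<omega> t v \<noteq> Listen \<longleftrightarrow>
        v \<in> A \<and> \<omega> v \<in> transmits_blindly alg n t v" for v
      using assms(1,2)
      by (auto simp: action_in_def choose_actions_def H transmits_blindly_def space_PiM PiE_iff)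
    then show ?case
      using assms(3)[OF less.prems] by (simp add: broadcasts_alone_def)
  qed
  then have "\<not> (LEAST t. broadcasts_alone alg n A \<omega> t) < T"
    if "broadcasts_alone alg n A \<omega> t" for t
    using LeastI[of "broadcasts_alone alg n A \<omega>", OF that] by blast
  then show ?thesis
    by (auto simp: wakeup_time_def) (meson leI le_SucI)
qed

text \<open>A union bound over the first \<open>T\<close> rounds bounds the probability of
  \<open>U\<close>, and outside \<open>U\<close> the wake-up time is at least \<open>T\<close>. If
  the left side is negative, \<open>ennreal\<close> truncates it to 0.\<close>

lemma expected_wakeup_time_ge:
  assumes alg: "randomized_algorithm alg" and A: "A \<subseteq> {1..n}"
  shows "ennreal (real T * (1 - (\<Sum>t<T. solo_prob (blind_prob alg n t) A))) \<le>
    expected_wakeup_time alg n A"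
proof -
  let ?M = "PiM {1..n} (seed alg n)"
  define S where "S t = {\<omega> \<in> space ?M. \<exists>!v. v \<in> A \<and> \<omega> v \<in> transmits_blindly alg n t v}" for t
  have prob: "prob_space (seed alg n v)" if "v \<in> {1..n}" for v
    using alg that by (simp add: randomized_algorithm_def)
  have meas: "transmits_blindly alg n t v \<in> sets (seed alg n v)" if "v \<in> {1..n}" for t v
  proof -
    have "(\<lambda>s. act alg n v s (replicate t None)) \<in> measurable (seed alg n v) (count_space UNIV)"
      using alg that unfolding randomized_algorithm_def by blast
    from measurable_sets[OF this, of "- {Listen}"] show ?thesis
      by (auto simp: transmits_blindly_def vimage_def Int_def conj_commute)
  qed
  have S: "S t \<in> sets ?M" "measure ?M (S t) = solo_prob (blind_prob alg n t) A" for t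
    unfolding S_def solo_prob_def blind_prob_def
    by (rule sets_PiM_ex1 measure_PiM_ex1, use A prob meas in simp_all)+
  interpret prob_space ?M
    using prob by (rule prob_space_PiM)
  define U where "U = (\<Union>t<T. S t)"
  have U: "U \<in> events" unfolding U_def using S by blast
  have "prob U \<le> (\<Sum>t<T. solo_prob (blind_prob alg n t) A)"
    using finite_measure_subadditive_finite[of "{..<T}" S] S by (auto simp: U_def)
  then have "1 - (\<Sum>t<T. solo_prob (blind_prob alg n t) A) \<le> prob (space ?M - U)"
    using prob_compl[OF U] by simp
  then have "ennreal (real T * (1 - (\<Sum>t<T. solo_prob (blind_prob alg n t) A))) \<le>
      ennreal (real T * prob (space ?M - U))"
    by (intro ennreal_leI mult_left_mono) auto
  also have "\<dots> = (\<integral>\<^sup>+ \<omega>. of_nat T * indicator (space ?M - U) \<omega> \<partial>?M)"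
    using U by (subst nn_integral_cmult_indicator)
      (auto simp: emeasure_eq_measure ennreal_mult ennreal_of_nat_eq_real_of_nat
        simp del: One_nat_def)
  also have "\<dots> \<le> expected_wakeup_time alg n A"
    unfolding expected_wakeup_time_def
  proof (rule nn_integral_mono)
    fix \<omega> assume \<omega>: "\<omega> \<in> space ?M"
    show "of_nat T * indicator (space ?M - U) \<omega> \<le> ennreal_of_enat (wakeup_time alg n A \<omega>)"
    proof (cases "\<omega> \<in> U")
      case False
      then have "enat T \<le> wakeup_time alg n A \<omega>"
        using \<omega> by (intro wakeup_time_ge[OF A]) (auto simp: U_def S_def)
      then have "ennreal_of_enat (enat T) \<le> ennreal_of_enat (wakeup_time alg n A \<omega>)"
        by (simp only: ennreal_of_enat_le_iff)
      then show ?thesis by (auto simp: indicator_def)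
    qed simp
  qed
  finally show ?thesis .
qed

section \<open>Averaging over the activation scales\<close>

text \<open>The condition \<open>2 ^ (k - 1) \<le> n\<close> keeps all \<open>k\<close> activation
  probabilities at least \<open>1 / n\<close>, so the active set is empty with probability at most
  \<open>exp (- 1)\<close>. The \<open>max 0\<close> reflects that \<open>ennreal (f n)\<close>
  truncates negative values.\<close>

lemma solves_wakeup_in_ge:
  assumes alg: "randomized_algorithm alg" and sol: "solves_wakeup_in alg f"
    and "0 < k" "2 ^ (k - 1) \<le> n"
  shows "real (k div 24) / 4 \<le> max 0 (f n)"
proof -
  define T where "T = k div 24"
  define F where "F = max 0 (f n)"
  let ?I = "{1..n}"
  let ?q = "\<lambda>i::nat. (1 / 2 :: real) ^ i"
  let ?W = "\<lambda>i. subset_weight (?q i) ?I"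
  let ?G = "\<lambda>A. \<Sum>t<T. solo_prob (blind_prob alg n t) A"
  have "1 \<le> n" using assms(4) by (metis le_trans one_le_numeral one_le_power)
  have p: "0 \<le> blind_prob alg n t v" "blind_prob alg n t v \<le> 1" if "v \<in> ?I" for t v
    using alg that by (auto simp: randomized_algorithm_def blind_prob_def
        intro!: prob_space.prob_le_1)
  have W_nonneg: "0 \<le> ?W i A" for i A
    by (simp add: subset_weight_def power_le_one)
  have le_F: "real T * (1 - ?G A) \<le> F" if "A \<subseteq> ?I" "A \<noteq> {}" for A
  proof -
    have "ennreal (real T * (1 - ?G A)) \<le> ennreal (f n)"
      using expected_wakeup_time_ge[OF alg that(1)] sol \<open>1 \<le> n\<close> that
      unfolding solves_wakeup_in_def by (blast intro: order_trans)
    then show ?thesis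
      unfolding F_def ennreal_le_iff2 by linarith
  qed
  have W_empty: "?W i {} \<le> 1 / 2" if "i < k" for i
  proof -
    have "1 / real n \<le> ?q i"
    proof -
      have "(2::nat) ^ i \<le> 2 ^ (k - 1)" using that by (intro power_increasing) auto
      then have "real (2 ^ i) \<le> real n" using assms(4) of_nat_mono order_trans by blast
      then show ?thesis by (simp add: power_divide frac_le)
    qed
    have "?W i {} = (1 - ?q i) ^ n" by (simp add: subset_weight_def)
    also have "\<dots> \<le> exp (- ?q i) ^ n"
      using exp_ge_add_one_self[of "- ?q i"] by (intro power_mono) (auto simp: power_le_one)
    also have "\<dots> = exp (- (real n * ?q i))" by (simp flip: exp_of_nat_mult)
    also have "\<dots> \<le> exp (- 1)"
      using \<open>1 / real n \<le> ?q i\<close> \<open>1 \<le> n\<close> by (simp add: divide_simps mult.commute)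
    also have "\<dots> \<le> 1 / 2"
      using exp_ge_add_one_self[of 1] by (simp add: exp_minus field_simps)
    finally show ?thesis .
  qed
  have avg: "real T * (1 / 2 - (\<Sum>t<T. solo_prob (\<lambda>v. ?q i * blind_prob alg n t v) ?I)) \<le> F"
    if "i < k" for i
  proof -
    have "(\<Sum>A\<in>Pow ?I. ?W i A * ?G A) =
        (\<Sum>t<T. \<Sum>A\<in>Pow ?I. ?W i A * solo_prob (blind_prob alg n t) A)"
      unfolding sum_distrib_left by (rule sum.swap)
    also have "\<dots> = (\<Sum>t<T. solo_prob (\<lambda>v. ?q i * blind_prob alg n t v) ?I)"
      by (simp add: sum_subset_weight_solo_prob)
    finally have G: "(\<Sum>A\<in>Pow ?I. ?W i A * ?G A) =
      (\<Sum>t<T. solo_prob (\<lambda>v. ?q i * blind_prob alg n t v) ?I)" .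
    \<comment> \<open>The guarantee on \<open>f\<close> covers non-empty sets only, so the empty set
      is split off; its solo probability is 0.\<close>
    have remove: "sum h (Pow ?I) = h {} + sum h (Pow ?I - {{}})" for h :: "nat set \<Rightarrow> real"
      by (intro sum.remove) auto
    have W1: "(\<Sum>A\<in>Pow ?I - {{}}. ?W i A) = 1 - ?W i {}"
      using remove[of "?W i"] sum_subset_weight[of ?I "?q i"] by simp
    have "?G {} = 0" by (simp add: solo_prob_def)
    then have G1: "(\<Sum>A\<in>Pow ?I - {{}}. ?W i A * ?G A) = (\<Sum>A\<in>Pow ?I. ?W i A * ?G A)"
      using remove[of "\<lambda>A. ?W i A * ?G A"] by simp
    have linear: "c * (sum w X - (\<Sum>A\<in>X. w A * g A)) = (\<Sum>A\<in>X. w A * (c * (1 - g A)))"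
      for c :: real and w g :: "nat set \<Rightarrow> real" and X
      by (simp add: right_diff_distrib sum_subtractf sum_distrib_left mult_ac)
    have "real T * (1 / 2 - (\<Sum>A\<in>Pow ?I. ?W i A * ?G A)) \<le>
        real T * ((1 - ?W i {}) - (\<Sum>A\<in>Pow ?I. ?W i A * ?G A))"
      using W_empty[OF that] by (intro mult_left_mono) auto
    also have "\<dots> = (\<Sum>A\<in>Pow ?I - {{}}. ?W i A * (real T * (1 - ?G A)))"
      unfolding G1[symmetric] W1[symmetric] by (rule linear)
    also have "\<dots> \<le> (\<Sum>A\<in>Pow ?I - {{}}. ?W i A * F)"
      by (intro sum_mono mult_left_mono le_F W_nonneg) auto
    also have "\<dots> = (1 - ?W i {}) * F" by (simp only: W1 flip: sum_distrib_right)
    \<comment> \<open>Dropping the factor \<open>1 - ?W i {}\<close> relies on \<open>F\<close>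
      being non-negative.\<close>
    also have "\<dots> \<le> F"
      using W_nonneg[of i "{}"] by (simp add: F_def mult_left_le_one_le algebra_simps)
    finally show ?thesis by (simp only: G)
  qed
  \<comment> \<open>After the exchange of sums, each round contributes at most 6 over all scales.
    The divisor 24 in \<open>T\<close> makes \<open>6 * T \<le> k / 4\<close>, half of the total
    \<open>k / 2\<close> gained from non-emptiness.\<close>
  have "(\<Sum>i<k. \<Sum>t<T. solo_prob (\<lambda>v. ?q i * blind_prob alg n t v) ?I) \<le> (\<Sum>t<T. 6)"
    by (subst sum.swap, intro sum_mono sum_dyadic_solo_prob_le p) auto
  then have six: "(\<Sum>i<k. \<Sum>t<T. solo_prob (\<lambda>v. ?q i * blind_prob alg n t v) ?I) \<le> real k / 4"
    using T_def by simp
  have "real T * (real k / 4) \<le> real T * (real k / 2 -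
      (\<Sum>i<k. \<Sum>t<T. solo_prob (\<lambda>v. ?q i * blind_prob alg n t v) ?I))"
    using six by (intro mult_left_mono) auto
  also have "\<dots> = (\<Sum>i<k. real T *
      (1 / 2 - (\<Sum>t<T. solo_prob (\<lambda>v. ?q i * blind_prob alg n t v) ?I)))"
    by (simp add: sum_subtractf flip: sum_distrib_left)
  also have "\<dots> \<le> (\<Sum>i<k. F)"
    by (intro sum_mono avg) auto
  finally have "real k * (real T / 4) \<le> real k * F" by (simp add: mult_ac)
  then show ?thesis using \<open>0 < k\<close> by (simp add: T_def F_def)
qed

theorem theorem5p2:
  fixes alg :: "('s, 'm) algorithm" and f :: "nat \<Rightarrow> real"
  assumes "randomized_algorithm alg"
    and "solves_wakeup_in alg f"
  shows "f \<in> \<Omega>(\<lambda>n. ln (real n))"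
proof (rule landau_omega.bigI)
  \<comment> \<open>For \<open>k \<ge> 48\<close>, \<open>(k / 24 - 1) / 4 \<ge> k / 192\<close>.
    Since \<open>k \<ge> ln n\<close>, the threshold 49 below ensures this and forces
    \<open>f n\<close> to be positive.\<close>
  show "(0::real) < 1 / 192" by simp
  have "filterlim (\<lambda>n. ln (real n)) at_top sequentially"
    by (rule filterlim_compose[OF ln_at_top filterlim_real_sequentially])
  then have "eventually (\<lambda>n. ln (real n) \<ge> 49) sequentially"
    by (simp add: filterlim_at_top)
  then show "eventually (\<lambda>n. norm (f n) \<ge> 1 / 192 * norm (ln (real n))) sequentially"
    using eventually_gt_at_top[of 0]
  proof eventually_elim
    case (elim n)
    \<comment> \<open>The successor gives both \<open>2 ^ (k - 1) \<le> n\<close> and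
      \<open>log 2 n \<le> k\<close>.\<close>
    define k where "k = Suc (nat \<lfloor>log 2 (real n)\<rfloor>)"
    have "0 \<le> log 2 (real n)" using elim by simp
    have "real (2 ^ (k - 1)) = 2 powr real (nat \<lfloor>log 2 (real n)\<rfloor>)"
      by (simp add: k_def powr_realpow)
    also have "\<dots> \<le> 2 powr log 2 (real n)"
      using \<open>0 \<le> log 2 (real n)\<close> by (intro powr_mono) auto
    also have "\<dots> = real n" using elim by simp
    finally have "2 ^ (k - 1) \<le> n" by linarith
    then have "real (k div 24) / 4 \<le> max 0 (f n)"
      by (intro solves_wakeup_in_ge[OF assms]) (auto simp: k_def)
    moreover have "ln (real n) \<le> log 2 (real n)"
    proof -
      have "ln (real n) * ln 2 \<le> ln (real n) * 1"
        using elim ln_2_less_1 by (intro mult_left_mono) auto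
      then show ?thesis by (simp add: log_def field_simps)
    qed
    moreover have "log 2 (real n) \<le> real k"
      unfolding k_def by linarith
    moreover have "real k / 24 - 1 \<le> real (k div 24)"
    proof -
      have "k \<le> 24 * (k div 24) + 24" by presburger
      then have "real k \<le> real (24 * (k div 24) + 24)" by (simp only: of_nat_le_iff)
      then show ?thesis by simp
    qed
    ultimately show ?case using elim by auto
  qed
qed

end
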